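(* Let $\mathcal{A}$ be a finite alphabet and let $F:\mathcal{A}^{\mathbb{N}}\to\mathcal{A}^{\mathbb{N}}$ be a continuous function. Then $\mathrm{Uni}(F)$ is a $G_\delta$ subset of $[0,1]$, i.e. a countable intersection of open subsets of $[0,1]$. Moreover, $1\in\mathrm{Uni}(F)$.
   Context: $\mathcal{A}^{\mathbb{N}}$ has the product topology and Borel $\sigma$-algebra. For a continuous $F:\mathcal{A}^{\mathbb{N}}\to\mathcal{A}^{\mathbb{N}}$ and $\epsilon\in[0,1]$, the computer perturbation $F_\epsilon$ of size $\epsilon$ is the probability kernel on $\mathcal{A}^{\mathbb{N}}$ such that for all $x\in\mathcal{A}^{\mathbb{N}}$, all finite $U\subset\mathbb{N}$ and all $\omega\in\mathcal{A}^U$, $$F_\epsilon(x,[\omega]_U)=\prod_{i\in U}\left((1-\epsilon)\mathbf{1}_{\omega_i=F(x)_i}+\frac{\epsilon}{|\mathcal{A}|}\right),\qquad [\omega]_U=\{y\in\mathcal{A}^{\mathbb{N}}: y_U=\omega\}.$$ It acts on Borel probability measures by $F_\epsilon\mu(A)=\int F_\epsilon(x,A)\,d\mu(x)$; $\mu$ is $F_\epsilon$-invariant if $F_\epsilon\mu=\mu$. $\mathrm{Uni}(F)$ is the set of $\epsilon\in[0,1]$ such that $F_\epsilon$ has a unique invariant probability measure. *)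

theory Defs
  imports "HOL-Probability.Probability"
begin

text \<open>
  The alphabet is a type \<open>'a :: {finite, discrete_topology}\<close>, so that the library topology on
  \<open>nat \<Rightarrow> 'a\<close> is the product of discrete topologies, and \<^term>\<open>borel\<close> is its Borel \<open>\<sigma>\<close>-algebra.
\<close>

text \<open>The pattern \<open>\<omega>\<close> is a total function, of which only the values on \<open>U\<close> matter.\<close>

definition cylinder :: "nat set \<Rightarrow> (nat \<Rightarrow> 'a) \<Rightarrow> (nat \<Rightarrow> 'a) set" where
  "cylinder U \<omega> = {y. \<forall>i\<in>U. y i = \<omega> i}"

definition is_computer_perturbation ::
  "((nat \<Rightarrow> 'a::{finite, discrete_topology}) \<Rightarrow> (nat \<Rightarrow> 'a)) \<Rightarrow> real
    \<Rightarrow> ((nat \<Rightarrow> 'a) \<Rightarrow> (nat \<Rightarrow> 'a) measure) \<Rightarrow> bool" where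
  "is_computer_perturbation F \<epsilon> K \<longleftrightarrow>
     K \<in> borel \<rightarrow>\<^sub>M prob_algebra borel \<and>
     (\<forall>x U \<omega>. finite U \<longrightarrow>
        measure (K x) (cylinder U \<omega>)
          = (\<Prod>i\<in>U. (1 - \<epsilon>) * of_bool (\<omega> i = F x i) + \<epsilon> / real CARD('a)))"

text \<open>Well defined for continuous \<open>F\<close> and \<open>\<epsilon> \<in> [0,1]\<close>: see \<open>ex1_computer_perturbation\<close> below.\<close>

definition computer_perturbation ::
  "((nat \<Rightarrow> 'a::{finite, discrete_topology}) \<Rightarrow> (nat \<Rightarrow> 'a)) \<Rightarrow> real
    \<Rightarrow> (nat \<Rightarrow> 'a) \<Rightarrow> (nat \<Rightarrow> 'a) measure" where
  "computer_perturbation F \<epsilon> = (THE K. is_computer_perturbation F \<epsilon> K)"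

text \<open>The action of a kernel \<open>K\<close> on a measure \<open>\<mu>\<close> is the Giry bind \<open>\<mu> \<bind> K\<close>; see \<open>emeasure_bind\<close>.\<close>

definition invariant_prob ::
  "((nat \<Rightarrow> 'a::{finite, discrete_topology}) \<Rightarrow> (nat \<Rightarrow> 'a)) \<Rightarrow> real
    \<Rightarrow> (nat \<Rightarrow> 'a) measure \<Rightarrow> bool" where
  "invariant_prob F \<epsilon> \<mu> \<longleftrightarrow>
     prob_space \<mu> \<and> sets \<mu> = sets borel \<and> \<mu> \<bind> computer_perturbation F \<epsilon> = \<mu>"

definition Uni :: "((nat \<Rightarrow> 'a::{finite, discrete_topology}) \<Rightarrow> (nat \<Rightarrow> 'a)) \<Rightarrow> real set" where
  "Uni F = {\<epsilon> \<in> {0..1}. \<exists>!\<mu>. invariant_prob F \<epsilon> \<mu>}"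


subsection \<open>Existence and uniqueness of the perturbed kernel\<close>

definition cylinders :: "(nat \<Rightarrow> 'a) set set" where
  "cylinders = insert {} {cylinder U \<omega> |U \<omega>. finite U}"

lemma Int_stable_cylinders: "Int_stable (cylinders :: (nat \<Rightarrow> 'a) set set)"
proof (rule Int_stableI)
  fix A B :: "(nat \<Rightarrow> 'a) set"
  assume A: "A \<in> cylinders" and B: "B \<in> cylinders"
  show "A \<inter> B \<in> cylinders"
  proof (cases "A \<inter> B = {}")
    case True then show ?thesis by (simp add: cylinders_def)
  next
    case False
    then obtain z where z: "z \<in> A" "z \<in> B" by blast
    with A obtain U u where U: "finite U" "A = cylinder U u" by (auto simp: cylinders_def)
    from z B obtain V v where V: "finite V" "B = cylinder V v" by (auto simp: cylinders_def)
    have "A \<inter> B = cylinder (U \<union> V) z" using z U V by (auto simp: cylinder_def)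
    then show ?thesis using U V by (auto simp: cylinders_def)
  qed
qed

lemma open_cylinder:
  fixes \<omega> :: "nat \<Rightarrow> 'a::discrete_topology"
  assumes "finite U"
  shows "open (cylinder U \<omega>)"
proof -
  have "cylinder U \<omega> = (\<Pi>\<^sub>E i\<in>UNIV. if i \<in> U then {\<omega> i} else UNIV)"
    by (auto simp: cylinder_def PiE_def Pi_def split: if_splits)
  moreover have "finite {i. (if i \<in> U then {\<omega> i} else UNIV) \<noteq> (UNIV :: 'a set)}"
    by (rule finite_subset[OF _ assms]) auto
  ultimately show ?thesis by (auto intro!: open_PiE simp: discrete_topology_class.open_discrete)
qed

lemma open_contains_cylinder:
  fixes S :: "(nat \<Rightarrow> 'a::topological_space) set"
  assumes "open S" "x \<in> S"
  shows "\<exists>n. cylinder {..<n} x \<subseteq> S"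
proof -
  obtain X where X: "x \<in> (\<Pi>\<^sub>E i\<in>UNIV. X i)" "finite {i. X i \<noteq> UNIV}" "(\<Pi>\<^sub>E i\<in>UNIV. X i) \<subseteq> S"
    using product_topology_open_contains_basis[of "\<lambda>_::nat. euclidean :: 'a topology" UNIV S x] assms
    by (auto simp: open_fun_def)
  from X(2) obtain n where n: "\<And>i. X i \<noteq> UNIV \<Longrightarrow> i < n"
    using finite_nat_set_iff_bounded by auto
  have "cylinder {..<n} x \<subseteq> (\<Pi>\<^sub>E i\<in>UNIV. X i)"
  proof
    fix y assume y: "y \<in> cylinder {..<n} x"
    have "y i \<in> X i" for i
      using y X(1) n[of i] by (cases "i < n") (auto simp: cylinder_def PiE_def Pi_def)
    then show "y \<in> (\<Pi>\<^sub>E i\<in>UNIV. X i)" by auto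
  qed
  with X(3) show ?thesis by blast
qed

lemma sets_borel_eq_cylinders:
  "sets (borel :: (nat \<Rightarrow> 'a::{finite, discrete_topology}) measure) = sigma_sets UNIV cylinders"
proof
  show "sigma_sets UNIV (cylinders :: (nat \<Rightarrow> 'a) set set) \<subseteq> sets borel"
  proof -
    have "(cylinders :: (nat \<Rightarrow> 'a) set set) \<subseteq> sets borel"
      by (auto simp: cylinders_def intro!: borel_open open_cylinder)
    from sets.sigma_sets_subset[OF this] show ?thesis by simp
  qed
next
  let ?C = "\<Union>n. cylinder {..<n} ` ({..<n} \<rightarrow>\<^sub>E (UNIV :: 'a set))"
  have C: "countable ?C"
    by (intro countable_UN countable_image countableI_type countable_finite[OF finite_PiE]) auto
  have "S \<in> sigma_sets UNIV cylinders" if S: "open S" for S :: "(nat \<Rightarrow> 'a) set"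
  proof -
    have "S = \<Union>{A \<in> ?C. A \<subseteq> S}"
    proof
      show "S \<subseteq> \<Union>{A \<in> ?C. A \<subseteq> S}"
      proof
        fix x assume "x \<in> S"
        from open_contains_cylinder[OF S this] obtain n where n: "cylinder {..<n} x \<subseteq> S" ..
        have eq: "cylinder {..<n} x = cylinder {..<n} (restrict x {..<n})"
          by (auto simp: cylinder_def)
        have "restrict x {..<n} \<in> {..<n} \<rightarrow>\<^sub>E UNIV" by auto
        then have "cylinder {..<n} x \<in> ?C" unfolding eq by blast
        moreover have "x \<in> cylinder {..<n} x" by (simp add: cylinder_def)
        ultimately show "x \<in> \<Union>{A \<in> ?C. A \<subseteq> S}" using n by blast
      qed
    qed auto
    also have "\<dots> \<in> sigma_sets UNIV cylinders"
    proof (rule sigma_sets_UNION)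
      show "countable {A \<in> ?C. A \<subseteq> S}" by (rule countable_subset[OF _ C]) auto
      have "?C \<subseteq> cylinders" by (auto simp: cylinders_def)
      then show "A \<in> sigma_sets UNIV cylinders" if "A \<in> {A \<in> ?C. A \<subseteq> S}" for A
        using that by (blast intro: sigma_sets.Basic)
    qed
    finally show ?thesis .
  qed
  then show "sets (borel :: (nat \<Rightarrow> 'a) measure) \<subseteq> sigma_sets UNIV cylinders"
    unfolding borel_def by (auto intro!: sigma_sets_mono)
qed

lemma measure_eqI_cylinders:
  fixes M N :: "(nat \<Rightarrow> 'a::{finite, discrete_topology}) measure"
  assumes "prob_space M" "prob_space N" and sets: "sets M = sets borel" "sets N = sets borel"
    and eq: "\<And>U \<omega>. finite U \<Longrightarrow> measure M (cylinder U \<omega>) = measure N (cylinder U \<omega>)"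
  shows "M = N"
proof (rule measure_eqI_generator_eq[OF Int_stable_cylinders, where \<Omega> = UNIV and A = "\<lambda>_. UNIV"])
  interpret M: prob_space M by fact
  interpret N: prob_space N by fact
  show "emeasure M X = emeasure N X" if "X \<in> cylinders" for X
    using that eq by (auto simp: cylinders_def M.emeasure_eq_measure N.emeasure_eq_measure)
  show "range (\<lambda>_. UNIV) \<subseteq> (cylinders :: (nat \<Rightarrow> 'a) set set)"
    by (auto simp: cylinders_def cylinder_def intro!: exI[of _ "{}"])
  show "emeasure M UNIV \<noteq> \<infinity>" by simp
qed (auto simp: sets sets_borel_eq_cylinders)

lemma ex1_computer_perturbation:
  fixes F :: "(nat \<Rightarrow> 'a::{finite, discrete_topology}) \<Rightarrow> (nat \<Rightarrow> 'a)"
  assumes F: "continuous_on UNIV F" and \<epsilon>: "\<epsilon> \<in> {0..1}"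
  shows "\<exists>!K. is_computer_perturbation F \<epsilon> K"
proof (rule ex_ex1I)
  define p where "p a = bind_pmf (bernoulli_pmf \<epsilon>)
    (\<lambda>b. if b then pmf_of_set (UNIV :: 'a set) else return_pmf a)" for a
  have p: "pmf (p a) b = (1 - \<epsilon>) * of_bool (b = a) + \<epsilon> / real CARD('a)" for a b
    using \<epsilon> by (auto simp: p_def pmf_bind indicator_def)
  define K where "K x = PiM UNIV (\<lambda>i::nat. measure_pmf (p (F x i)))" for x
  interpret K: product_prob_space "\<lambda>i. measure_pmf (p (F x i))" UNIV for x
    by unfold_locales
  have "sets (K x) = sets (PiM (UNIV::nat set) (\<lambda>_. count_space (UNIV :: 'a set)))" for x
    unfolding K_def by (rule sets_PiM_cong) auto
  also have "\<dots> = sigma_sets UNIV cylinders"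
  proof
    have c: "cylinder {i} (\<lambda>_. b) = {f. f i = b}" for i :: nat and b :: 'a
      by (auto simp: cylinder_def)
    have "{f. f i \<in> A} \<in> sigma_sets UNIV cylinders" for i and A :: "'a set"
    proof -
      have "{f :: nat \<Rightarrow> 'a. f i \<in> A} = \<Union>((\<lambda>b. cylinder {i} (\<lambda>_. b)) ` A)"
        by (auto simp: c)
      also have "\<dots> \<in> sigma_sets UNIV cylinders"
        by (rule sigma_sets_UNION) (auto simp: cylinders_def intro!: sigma_sets.Basic countable_finite)
      finally show ?thesis .
    qed
    then show "sets (PiM (UNIV::nat set) (\<lambda>_. count_space (UNIV :: 'a set))) \<subseteq> sigma_sets UNIV cylinders"
      unfolding sets_PiM_single by (auto simp: intro!: sigma_sets_mono)
    have "cylinder U \<omega> \<in> sets (PiM (UNIV::nat set) (\<lambda>_. count_space (UNIV :: 'a set)))"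
      if "finite U" for U \<omega>
    proof -
      have "cylinder U \<omega> = prod_emb UNIV (\<lambda>_. count_space UNIV) U (\<Pi>\<^sub>E i\<in>U. {\<omega> i})"
        by (auto simp: cylinder_def prod_emb_def PiE_iff space_PiM)
      then show ?thesis using that by (auto intro!: sets_PiM_I)
    qed
    then have "(cylinders :: (nat \<Rightarrow> 'a) set set) \<subseteq> sets (PiM UNIV (\<lambda>_. count_space UNIV))"
      by (auto simp: cylinders_def)
    from sets.sigma_sets_subset[OF this]
    show "sigma_sets UNIV cylinders \<subseteq> sets (PiM (UNIV::nat set) (\<lambda>_. count_space (UNIV :: 'a set)))"
      by (simp add: space_PiM)
  qed
  finally have setsK: "sets (K x) = sigma_sets UNIV cylinders" for x .
  have meas: "measure (K x) (cylinder U \<omega>)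
      = (\<Prod>i\<in>U. (1 - \<epsilon>) * of_bool (\<omega> i = F x i) + \<epsilon> / real CARD('a))" if "finite U" for x U \<omega>
  proof -
    have "cylinder U \<omega> = prod_emb UNIV (\<lambda>i. measure_pmf (p (F x i))) U (\<Pi>\<^sub>E i\<in>U. {\<omega> i})"
      by (auto simp: cylinder_def prod_emb_def PiE_iff space_PiM)
    then have "measure (K x) (cylinder U \<omega>) = (\<Prod>i\<in>U. measure (measure_pmf (p (F x i))) {\<omega> i})"
      unfolding K_def using that by (simp add: K.measure_PiM_emb)
    then show ?thesis by (simp add: measure_pmf_single p)
  qed
  have prob: "prob_space (K x)" for x
    unfolding K_def by (rule prob_space_PiM) (rule measure_pmf.prob_space_axioms)
  have F_meas: "F \<in> borel \<rightarrow>\<^sub>M borel" using F by (rule borel_measurable_continuous_onI)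
  have "(\<lambda>x. (1 - \<epsilon>) * of_bool (b = F x i) + \<epsilon> / real CARD('a)) \<in> borel_measurable borel" for b i
  proof -
    have "{x. F x \<in> cylinder {i} (\<lambda>_. b)} \<in> sets borel"
      using measurable_sets[OF F_meas borel_open[OF open_cylinder[of "{i}" "\<lambda>_. b"]]]
      by (simp add: vimage_def)
    then have "{x. b = F x i} \<in> sets borel" by (simp add: cylinder_def eq_commute)
    then have "(\<lambda>x. indicator {x. b = F x i} x :: real) \<in> borel_measurable borel"
      by (intro borel_measurable_indicator)
    moreover have "(\<lambda>x. of_bool (b = F x i)) = (\<lambda>x. indicator {x. b = F x i} x :: real)"
      by (auto simp: indicator_def)
    ultimately show ?thesis by (intro borel_measurable_add borel_measurable_times) simp_all
  qed
  note this[measurable]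
  have "K \<in> borel \<rightarrow>\<^sub>M prob_algebra borel"
  proof (rule measurable_prob_algebra_generated[OF sets_borel_eq_cylinders Int_stable_cylinders])
    show "(\<lambda>x. emeasure (K x) A) \<in> borel_measurable borel" if "A \<in> cylinders" for A
    proof -
      from that consider "A = {}" | U \<omega> where "finite U" "A = cylinder U \<omega>"
        by (auto simp: cylinders_def)
      then show ?thesis
      proof cases
        case 2
        have "emeasure (K x) A
          = ennreal (\<Prod>i\<in>U. (1 - \<epsilon>) * of_bool (\<omega> i = F x i) + \<epsilon> / real CARD('a))" for x
          using finite_measure.emeasure_eq_measure[OF prob_space.finite_measure[OF prob]] 2
          by (simp add: meas)
        then show ?thesis by simp
      qed simp
    qed
  qed (auto simp: prob setsK sets_borel_eq_cylinders)
  with meas show "\<exists>K. is_computer_perturbation F \<epsilon> K"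
    unfolding is_computer_perturbation_def by blast
next
  fix K L assume K: "is_computer_perturbation F \<epsilon> K" and L: "is_computer_perturbation F \<epsilon> L"
  show "K = L"
  proof
    fix x
    have "K x \<in> space (prob_algebra borel)" "L x \<in> space (prob_algebra borel)"
      using K L by (auto simp: is_computer_perturbation_def intro: measurable_space)
    with K L show "K x = L x"
      by (intro measure_eqI_cylinders) (auto simp: space_prob_algebra is_computer_perturbation_def)
  qed
qed

lemma is_computer_perturbation_computer_perturbation:
  assumes "continuous_on UNIV F" "\<epsilon> \<in> {0..1}"
  shows "is_computer_perturbation F \<epsilon> (computer_perturbation F \<epsilon>)"
  unfolding computer_perturbation_def by (rule theI'[OF ex1_computer_perturbation[OF assms]])

end

theory Submission
  imports Defs "HOL-Complex_Analysis.Great_Picard"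
begin

text \<open>
  Since \<open>F\<close> is continuous, preimages of cylinders are clopen, and \<open>\<mu>\<close> is \<open>F\<^sub>\<epsilon>\<close>-invariant iff its
  values on clopen sets satisfy, for every cylinder, a finite linear equation whose coefficients
  are polynomials in \<open>\<epsilon>\<close>. There are countably many clopen sets and every finitely additive
  probability on them extends to a Borel measure, so the pairs \<open>(\<epsilon>, \<mu>)\<close> with \<open>\<mu>\<close> invariant are
  sequentially compact for convergence on clopen sets. This yields existence of invariant
  measures (Krylov--Bogoliubov), and closedness of the set of those \<open>\<epsilon>\<close> that have two invariant
  measures differing by at least \<open>1 / (n + 1)\<close> on a given clopen set; the complement of
  \<open>Uni F\<close> is the countable union of these. For \<open>\<epsilon> = 1\<close> the right-hand side of the equation does
  not depend on \<open>\<mu>\<close>.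
\<close>

section \<open>Clopen sets and finitely additive probabilities on them\<close>

definition clopens :: "'b::topological_space set set" where
  "clopens = {A. open A \<and> closed A}"

lemma clopens_simps [simp]:
  "{} \<in> clopens" "UNIV \<in> clopens"
  "A \<in> clopens \<Longrightarrow> B \<in> clopens \<Longrightarrow> A \<union> B \<in> clopens"
  "A \<in> clopens \<Longrightarrow> B \<in> clopens \<Longrightarrow> A \<inter> B \<in> clopens"
  "A \<in> clopens \<Longrightarrow> B \<in> clopens \<Longrightarrow> A - B \<in> clopens"
  by (auto simp: clopens_def open_Diff closed_Diff)

lemma clopens_vimage:
  assumes "continuous_on UNIV f" "A \<in> clopens"
  shows "f -` A \<in> clopens"
  using assms by (auto simp: clopens_def open_vimage closed_vimage)

lemma clopens_borel: "A \<in> clopens \<Longrightarrow> A \<in> sets borel"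
  by (simp add: clopens_def)

text \<open>Each condition involves finitely many values of \<open>m\<close>, so it survives
  pointwise limits. On a compact space finite additivity already yields a countably additive
  extension.\<close>

definition clopen_charge :: "('b::topological_space set \<Rightarrow> real) \<Rightarrow> bool" where
  "clopen_charge m \<longleftrightarrow> (\<forall>A\<in>clopens. 0 \<le> m A) \<and> m UNIV = 1 \<and>
     (\<forall>A\<in>clopens. \<forall>B\<in>clopens. A \<inter> B = {} \<longrightarrow> m (A \<union> B) = m A + m B)"

lemma clopen_charge_empty: "clopen_charge m \<Longrightarrow> m {} = 0"
  unfolding clopen_charge_def by (metis Un_empty_left add_cancel_right_left clopens_simps(1) inf_bot_left)

lemma clopen_charge_le_1:
  assumes m: "clopen_charge m" and A: "A \<in> clopens"
  shows "m A \<le> 1"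
proof -
  have B: "UNIV - A \<in> clopens" using A by simp
  have "m (A \<union> (UNIV - A)) = m A + m (UNIV - A)"
    using m A B unfolding clopen_charge_def by blast
  moreover have "0 \<le> m (UNIV - A)" using m B unfolding clopen_charge_def by blast
  moreover have "m (A \<union> (UNIV - A)) = 1" using m by (simp add: clopen_charge_def)
  ultimately show ?thesis by linarith
qed

lemma clopen_charge_measure:
  fixes M :: "'b::topological_space measure"
  assumes "prob_space M" "sets M = sets borel"
  shows "clopen_charge (measure M)"
proof -
  interpret prob_space M by fact
  have "space M = UNIV" using assms(2) by (metis sets_eq_imp_space_eq space_borel)
  then show ?thesis
    using assms(2) prob_space by (auto simp: clopen_charge_def clopens_borel finite_measure_Union)
qed

text \<open>A decreasing sequence of clopen sets with empty intersection is eventually empty by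
  compactness, so Caratheodory's continuity condition at the empty set is automatic.\<close>

lemma clopen_charge_extends:
  fixes m :: "'b::topological_space set \<Rightarrow> real"
  assumes cpt: "compact (UNIV :: 'b set)" and m: "clopen_charge m"
  shows "\<exists>M. prob_space M \<and> sets M = sigma_sets UNIV clopens \<and> (\<forall>A\<in>clopens. measure M A = m A)"
proof -
  interpret ring_of_sets "UNIV :: 'b set" clopens
    by (simp add: ring_of_sets_iff)
  have nonneg: "0 \<le> m A" if "A \<in> clopens" for A using m that by (simp add: clopen_charge_def)
  have "\<exists>\<mu>. (\<forall>A\<in>clopens. \<mu> A = ennreal (m A)) \<and> measure_space UNIV (sigma_sets UNIV clopens) \<mu>"
  proof (rule caratheodory_empty_continuous)
    show "positive clopens (\<lambda>A. ennreal (m A))"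
      using clopen_charge_empty[OF m] by (simp add: positive_def)
    show "additive clopens (\<lambda>A. ennreal (m A))"
      unfolding additive_def using m nonneg by (auto simp: clopen_charge_def)
    show "(\<lambda>i. ennreal (m (A i))) \<longlonglongrightarrow> 0"
      if A: "range A \<subseteq> clopens" and dec: "decseq A" and empty: "(\<Inter>i. A i) = {}" for A :: "nat \<Rightarrow> 'b set"
    proof -
      have "\<exists>n. A n = {}"
      proof (rule ccontr)
        assume ne: "\<nexists>n. A n = {}"
        have "UNIV \<inter> (\<Inter>i\<in>UNIV. A i) \<noteq> {}"
        proof (rule compact_imp_fip_image[OF cpt])
          show "closed (A i)" for i using A by (auto simp: clopens_def)
          fix I :: "nat set" assume "finite I"
          \<comment> \<open>In a decreasing sequence the member of largest index in \<open>I\<close>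
            lies inside all the others; inserting \<open>0\<close> keeps the maximum meaningful for
            empty \<open>I\<close>.\<close>
          then have "A (Max (insert 0 I)) \<subseteq> (\<Inter>i\<in>I. A i)"
            using dec by (auto simp: decseq_def) (metis Max.coboundedI Max_insert2 finite.emptyI finite_insert insertCI subsetD)
          then show "UNIV \<inter> (\<Inter>i\<in>I. A i) \<noteq> {}" using ne by (metis Int_UNIV_left subset_empty)
        qed
        with empty show False by simp
      qed
      then obtain n where n: "A n = {}" ..
      have "eventually (\<lambda>i. ennreal (m (A i)) = 0) sequentially"
        using eventually_ge_at_top[of n]
      proof eventually_elim
        case (elim i)
        then have "A i = {}" using decseqD[OF dec elim] n by auto
        then show ?case using clopen_charge_empty[OF m] by simp
      qed
      then show ?thesis by (rule tendsto_eventually)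
    qed
  qed simp
  then obtain \<mu> where \<mu>: "\<And>A. A \<in> clopens \<Longrightarrow> \<mu> A = ennreal (m A)"
    and ms: "measure_space UNIV (sigma_sets UNIV clopens) \<mu>" by blast
  define M where "M = measure_of UNIV (sigma_sets UNIV clopens) \<mu>"
  have sets: "sets M = sigma_sets UNIV clopens" and space: "space M = UNIV"
    by (simp_all add: M_def sigma_sets_sigma_sets_eq)
  have em: "emeasure M A = ennreal (m A)" if "A \<in> clopens" for A
    unfolding M_def using that ms \<mu>
    by (subst emeasure_measure_of_sigma) (auto simp: measure_space_def)
  have "prob_space M"
    by (rule prob_spaceI) (use em[of UNIV] m in \<open>simp add: space clopen_charge_def\<close>)
  moreover have "measure M A = m A" if "A \<in> clopens" for A
    using em[OF that] nonneg[OF that] by (simp add: measure_def)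
  ultimately show ?thesis using sets by blast
qed

text \<open>Values lie in \<open>[0, 1]\<close>, so a diagonal argument over the countably many
  clopen sets extracts a subsequence converging on each of them. The limit values again form a
  charge, which extends to a measure.\<close>

lemma clopen_charge_convergent_subsequence:
  fixes m :: "nat \<Rightarrow> 'b::topological_space set \<Rightarrow> real"
  assumes cpt: "compact (UNIV :: 'b set)" and cnt: "countable (clopens :: 'b set set)"
    and m: "\<And>n. clopen_charge (m n)"
  shows "\<exists>r M. strict_mono r \<and> prob_space M \<and> sets M = sigma_sets UNIV clopens \<and>
    (\<forall>A\<in>clopens. (\<lambda>n. m (r n) A) \<longlonglongrightarrow> measure M A)"
proof -
  have "norm (m n A) \<le> 1" if "A \<in> clopens" for n A
    using clopen_charge_le_1[OF m that] m[of n] that by (auto simp: clopen_charge_def)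
  then obtain r where r: "strict_mono r"
    and conv: "\<And>A. A \<in> clopens \<Longrightarrow> \<exists>l. (\<lambda>n. m (r n) A) \<longlonglongrightarrow> l"
    using function_convergent_subsequence[OF cnt, of m 1] by blast
  define L where "L A = lim (\<lambda>n. m (r n) A)" for A
  have L: "(\<lambda>n. m (r n) A) \<longlonglongrightarrow> L A" if "A \<in> clopens" for A
    using conv[OF that] unfolding L_def by (auto simp: limI)
  have "clopen_charge L"
    unfolding clopen_charge_def
  proof (intro conjI ballI impI)
    show "0 \<le> L A" if "A \<in> clopens" for A
      using m that by (intro LIMSEQ_le_const[OF L[OF that]]) (auto simp: clopen_charge_def)
    show "L UNIV = 1"
      using L[of UNIV] m by (simp add: clopen_charge_def LIMSEQ_const_iff)
    fix A B :: "'b set" assume AB: "A \<in> clopens" "B \<in> clopens" "A \<inter> B = {}"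
    then have "m (r n) (A \<union> B) = m (r n) A + m (r n) B" for n
      using m by (auto simp: clopen_charge_def)
    then have "(\<lambda>n. m (r n) (A \<union> B)) \<longlonglongrightarrow> L A + L B"
      using tendsto_add[OF L[OF AB(1)] L[OF AB(2)]] by simp
    with L[of "A \<union> B"] AB show "L (A \<union> B) = L A + L B"
      by (auto intro: LIMSEQ_unique)
  qed
  from clopen_charge_extends[OF cpt this] r L show ?thesis by metis
qed

section \<open>Clopen sets in the sequence space\<close>

lemma compact_UNIV_sequences: "compact (UNIV :: (nat \<Rightarrow> 'a::{finite, topological_space}) set)"
proof -
  have "compactin (product_topology (\<lambda>_::nat. euclidean :: 'a topology) UNIV) (PiE UNIV (\<lambda>_. UNIV))"
    by (simp only: compactin_PiE) (simp add: finite_imp_compact)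
  then show ?thesis by (simp add: euclidean_product_topology)
qed

text \<open>By compactness a clopen set is a finite union of cylinders over initial segments, and
  there are only countably many such unions.\<close>

lemma countable_clopens_sequences:
  "countable (clopens :: (nat \<Rightarrow> 'a::{finite, discrete_topology}) set set)"
proof -
  let ?C = "\<Union>n. cylinder {..<n} ` ({..<n} \<rightarrow>\<^sub>E (UNIV :: 'a set))"
  have C: "countable ?C"
    by (intro countable_UN countable_image countableI_type countable_finite[OF finite_PiE]) auto
  have "clopens \<subseteq> Union ` {T. finite T \<and> T \<subseteq> ?C}"
  proof
    fix S :: "(nat \<Rightarrow> 'a) set" assume S: "S \<in> clopens"
    let ?D = "{A \<in> ?C. A \<subseteq> S}"
    have "compact S"
      using S compact_Int_closed[OF compact_UNIV_sequences, of S] by (auto simp: clopens_def)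
    moreover have "S \<subseteq> \<Union>?D"
    proof
      fix x assume "x \<in> S"
      then obtain n where n: "cylinder {..<n} x \<subseteq> S"
        using open_contains_cylinder[of S x] S by (auto simp: clopens_def)
      \<comment> \<open>\<open>?C\<close> is indexed by patterns that are \<open>undefined\<close>
        off \<open>{..<n}\<close>, so \<open>x\<close> is restricted before serving as an
        index.\<close>
      have eq: "cylinder {..<n} x = cylinder {..<n} (restrict x {..<n})"
        by (auto simp: cylinder_def)
      have "restrict x {..<n} \<in> {..<n} \<rightarrow>\<^sub>E UNIV" by auto
      then have "cylinder {..<n} x \<in> ?C" unfolding eq by blast
      moreover have "x \<in> cylinder {..<n} x" by (simp add: cylinder_def)
      ultimately show "x \<in> \<Union>?D" using n by blast
    qed
    moreover have "open T" if "T \<in> ?D" for T using that by (auto intro: open_cylinder)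
    ultimately obtain T where T: "T \<subseteq> ?D" "finite T" "S \<subseteq> \<Union>T" by (rule compactE)
    then have "S = \<Union>T" by blast
    with T show "S \<in> Union ` {T. finite T \<and> T \<subseteq> ?C}" by blast
  qed
  then show ?thesis
    by (rule countable_subset) (intro countable_image countable_Collect_finite_subset C)
qed

text \<open>Patterns in \<open>U \<rightarrow>\<^sub>E A\<close> have a fixed value off
  \<open>U\<close>. For \<open>A = UNIV\<close> each point thus lies in exactly one such cylinder,
  and sums over patterns collapse to one term.\<close>

lemma mem_cylinder_iff_restrict:
  assumes "\<eta> \<in> U \<rightarrow>\<^sub>E A"
  shows "y \<in> cylinder U \<eta> \<longleftrightarrow> \<eta> = restrict y U"
proof
  show "\<eta> = restrict y U" if "y \<in> cylinder U \<eta>"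
    using that assms by (intro ext) (auto simp: cylinder_def PiE_def extensional_def)
qed (auto simp: cylinder_def)

lemma cylinder_clopen:
  fixes \<omega> :: "nat \<Rightarrow> 'a::discrete_topology"
  assumes "finite U"
  shows "cylinder U \<omega> \<in> clopens"
proof -
  have "closed ((\<lambda>x::nat \<Rightarrow> 'a. x i) -` {\<omega> i})" for i
    by (intro closed_vimage) (simp_all add: closed_def discrete_topology_class.open_discrete)
  moreover have "cylinder U \<omega> = (\<Inter>i\<in>U. (\<lambda>x. x i) -` {\<omega> i})"
    by (auto simp: cylinder_def)
  ultimately have "closed (cylinder U \<omega>)" by auto
  with open_cylinder[OF assms] show ?thesis by (simp add: clopens_def)
qed

lemma sigma_sets_clopens_sequences:
  "sigma_sets UNIV clopens = sets (borel :: (nat \<Rightarrow> 'a::{finite, discrete_topology}) measure)"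
proof
  show "sigma_sets UNIV clopens \<subseteq> sets (borel :: (nat \<Rightarrow> 'a) measure)"
    using sets.sigma_sets_subset[of clopens "borel :: (nat \<Rightarrow> 'a) measure"] clopens_borel by auto
  have "cylinders \<subseteq> (clopens :: (nat \<Rightarrow> 'a) set set)"
    by (auto simp: cylinders_def cylinder_clopen)
  then show "sets (borel :: (nat \<Rightarrow> 'a) measure) \<subseteq> sigma_sets UNIV clopens"
    unfolding sets_borel_eq_cylinders by (rule sigma_sets_mono')
qed

lemmas convergent_subsequence_sequences = clopen_charge_convergent_subsequence
  [OF compact_UNIV_sequences countable_clopens_sequences, unfolded sigma_sets_clopens_sequences]

section \<open>Invariance as finite linear equations\<close>

text \<open>The mass that the kernel gives to \<open>cylinder U \<omega>\<close> at a point whose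
  image under \<open>F\<close> has pattern \<open>\<eta>\<close> on \<open>U\<close>.\<close>

definition cylinder_weight ::
    "real \<Rightarrow> nat set \<Rightarrow> (nat \<Rightarrow> 'a::finite) \<Rightarrow> (nat \<Rightarrow> 'a) \<Rightarrow> real" where
  "cylinder_weight \<epsilon> U \<eta> \<omega> = (\<Prod>i\<in>U. (1 - \<epsilon>) * of_bool (\<omega> i = \<eta> i) + \<epsilon> / real CARD('a))"

text \<open>The value on \<open>cylinder U \<omega>\<close> of the image of \<open>m\<close> under
  the kernel. Allowing a set function for \<open>m\<close> makes it applicable to Cesaro averages,
  in which it is linear.\<close>

definition perturbed_value ::
    "((nat \<Rightarrow> 'a::finite) \<Rightarrow> (nat \<Rightarrow> 'a)) \<Rightarrow> real \<Rightarrow> ((nat \<Rightarrow> 'a) set \<Rightarrow> real)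
      \<Rightarrow> nat set \<Rightarrow> (nat \<Rightarrow> 'a) \<Rightarrow> real" where
  "perturbed_value F \<epsilon> m U \<omega> =
     (\<Sum>\<eta>\<in>U \<rightarrow>\<^sub>E UNIV. m (F -` cylinder U \<eta>) * cylinder_weight \<epsilon> U \<eta> \<omega>)"

context
  fixes F :: "(nat \<Rightarrow> 'a::{finite, discrete_topology}) \<Rightarrow> (nat \<Rightarrow> 'a)"
  assumes F: "continuous_on UNIV F"
begin

text \<open>The kernel's mass on a cylinder over \<open>U\<close> depends on \<open>x\<close> only
  through the pattern of \<open>F x\<close> on \<open>U\<close>. The integrand is therefore a finite
  combination of indicators of preimages of cylinders.\<close>

lemma measure_bind_computer_perturbation:
  assumes \<epsilon>: "\<epsilon> \<in> {0..1}" and M: "prob_space M" "sets M = sets borel" and U: "finite U"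
  shows "measure (M \<bind> computer_perturbation F \<epsilon>) (cylinder U \<omega>)
    = perturbed_value F \<epsilon> (measure M) U \<omega>"
proof -
  interpret prob_space M by fact
  note K = is_computer_perturbation_computer_perturbation[OF F \<epsilon>, unfolded is_computer_perturbation_def]
  have weight: "measure (computer_perturbation F \<epsilon> x) (cylinder U \<omega>)
      = (\<Sum>\<eta>\<in>U \<rightarrow>\<^sub>E UNIV. indicator (F -` cylinder U \<eta>) x * cylinder_weight \<epsilon> U \<eta> \<omega>)" for x
  proof -
    have fin: "finite (U \<rightarrow>\<^sub>E (UNIV :: 'a set))" using U by (intro finite_PiE) auto
    have "(\<Sum>\<eta>\<in>U \<rightarrow>\<^sub>E UNIV. indicator (F -` cylinder U \<eta>) x * cylinder_weight \<epsilon> U \<eta> \<omega>)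
        = (\<Sum>\<eta>\<in>U \<rightarrow>\<^sub>E UNIV. if \<eta> = restrict (F x) U then cylinder_weight \<epsilon> U \<eta> \<omega> else 0)"
      by (intro sum.cong) (auto simp: indicator_def mem_cylinder_iff_restrict)
    also have "\<dots> = cylinder_weight \<epsilon> U (restrict (F x) U) \<omega>"
      using fin by (simp add: sum.delta)
    also have "\<dots> = cylinder_weight \<epsilon> U (F x) \<omega>"
      unfolding cylinder_weight_def by (intro prod.cong) auto
    finally show ?thesis using K U by (simp add: cylinder_weight_def)
  qed
  have sets: "F -` cylinder U \<eta> \<in> sets M" for \<eta>
    using clopens_vimage[OF F cylinder_clopen[OF U, of \<eta>]] by (simp add: M clopens_borel)
  have "computer_perturbation F \<epsilon> \<in> M \<rightarrow>\<^sub>M subprob_algebra borel"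
    using K M(2) measurable_prob_algebraD by (metis measurable_cong_sets)
  then have "measure (M \<bind> computer_perturbation F \<epsilon>) (cylinder U \<omega>)
      = (\<integral>x. measure (computer_perturbation F \<epsilon> x) (cylinder U \<omega>) \<partial>M)"
    using clopens_borel[OF cylinder_clopen[OF U]] by (rule measure_bind)
  also have "\<dots> = perturbed_value F \<epsilon> (measure M) U \<omega>"
    unfolding weight perturbed_value_def
    using sets by (subst Bochner_Integration.integral_sum) (auto simp: less_top[symmetric] sets.Int_space_eq2)
  finally show ?thesis .
qed

lemma bind_computer_perturbation:
  assumes "\<epsilon> \<in> {0..1}" "prob_space M" "sets M = sets borel"
  shows "prob_space (M \<bind> computer_perturbation F \<epsilon>)"
    and "sets (M \<bind> computer_perturbation F \<epsilon>) = sets borel"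
proof -
  have K: "computer_perturbation F \<epsilon> \<in> borel \<rightarrow>\<^sub>M prob_algebra borel"
    using is_computer_perturbation_computer_perturbation[OF F assms(1)]
    by (simp add: is_computer_perturbation_def)
  have M: "M \<in> space (prob_algebra borel)" using assms by (simp add: space_prob_algebra)
  show "prob_space (M \<bind> computer_perturbation F \<epsilon>)"
    and "sets (M \<bind> computer_perturbation F \<epsilon>) = sets borel"
    using prob_space_bind'[OF M K] sets_bind'[OF M K] by auto
qed

text \<open>Cylinders determine a Borel probability measure, so the fixed point equation can be
  tested on them. The resulting equations see \<open>\<mu>\<close> only through clopen sets, hence
  are stable under convergence on clopen sets.\<close>

lemma invariant_prob_iff:
  assumes "\<epsilon> \<in> {0..1}"
  shows "invariant_prob F \<epsilon> \<mu> \<longleftrightarrow> prob_space \<mu> \<and> sets \<mu> = sets borel \<and>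
    (\<forall>U \<omega>. finite U \<longrightarrow> measure \<mu> (cylinder U \<omega>) = perturbed_value F \<epsilon> (measure \<mu>) U \<omega>)"
proof -
  have "\<mu> \<bind> computer_perturbation F \<epsilon> = \<mu> \<longleftrightarrow>
    (\<forall>U \<omega>. finite U \<longrightarrow> measure \<mu> (cylinder U \<omega>) = perturbed_value F \<epsilon> (measure \<mu>) U \<omega>)"
    if \<mu>: "prob_space \<mu>" "sets \<mu> = sets borel"
  proof
    assume "\<mu> \<bind> computer_perturbation F \<epsilon> = \<mu>"
    then show "\<forall>U \<omega>. finite U \<longrightarrow> measure \<mu> (cylinder U \<omega>) = perturbed_value F \<epsilon> (measure \<mu>) U \<omega>"
      using measure_bind_computer_perturbation[OF assms \<mu>] by metis
  next
    assume "\<forall>U \<omega>. finite U \<longrightarrow> measure \<mu> (cylinder U \<omega>) = perturbed_value F \<epsilon> (measure \<mu>) U \<omega>"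
    then show "\<mu> \<bind> computer_perturbation F \<epsilon> = \<mu>"
      using measure_bind_computer_perturbation[OF assms \<mu>] bind_computer_perturbation[OF assms \<mu>] \<mu>
      by (intro measure_eqI_cylinders) auto
  qed
  then show ?thesis by (auto simp: invariant_prob_def)
qed

section \<open>Limits of asymptotically invariant charges\<close>

text \<open>Continuity of \<open>F\<close> makes preimages of cylinders clopen, so each of the
  finitely many terms converges.\<close>

lemma tendsto_perturbed_value:
  assumes e: "e \<longlonglongrightarrow> \<epsilon>" and m: "\<And>A. A \<in> clopens \<Longrightarrow> (\<lambda>n. m n A) \<longlonglongrightarrow> l A" and U: "finite U"
  shows "(\<lambda>n. perturbed_value F (e n) (m n) U \<omega>) \<longlonglongrightarrow> perturbed_value F \<epsilon> l U \<omega>"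
  unfolding perturbed_value_def cylinder_weight_def
  by (intro tendsto_intros e m clopens_vimage[OF F] cylinder_clopen U) simp

text \<open>A vanishing defect in place of exact equations covers both uses: Cesaro averages at a
  fixed parameter, and invariant measures at varying parameters. The defect tends to that of the
  limit measure, which is therefore zero.\<close>

lemma invariant_prob_limit:
  assumes "\<And>n. clopen_charge (m n)" and e: "e \<longlonglongrightarrow> \<epsilon>" and \<epsilon>: "\<epsilon> \<in> {0..1}"
    and m: "\<And>U \<omega>. finite U \<Longrightarrow>
      (\<lambda>n. m n (cylinder U \<omega>) - perturbed_value F (e n) (m n) U \<omega>) \<longlonglongrightarrow> 0"
  shows "\<exists>r \<mu>. strict_mono r \<and> invariant_prob F \<epsilon> \<mu> \<and>
    (\<forall>A\<in>clopens. (\<lambda>n. m (r n) A) \<longlonglongrightarrow> measure \<mu> A)"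
proof -
  obtain r \<mu> where r: "strict_mono r" and \<mu>: "prob_space \<mu>" "sets \<mu> = sets borel"
    and conv: "\<And>A. A \<in> clopens \<Longrightarrow> (\<lambda>n. m (r n) A) \<longlonglongrightarrow> measure \<mu> A"
    using convergent_subsequence_sequences[of m] assms(1) by blast
  have er: "(\<lambda>n. e (r n)) \<longlonglongrightarrow> \<epsilon>"
    using LIMSEQ_subseq_LIMSEQ[OF e r] by (simp add: o_def)
  have "measure \<mu> (cylinder U \<omega>) = perturbed_value F \<epsilon> (measure \<mu>) U \<omega>" if U: "finite U" for U \<omega>
  proof -
    have "(\<lambda>n. m (r n) (cylinder U \<omega>) - perturbed_value F (e (r n)) (m (r n)) U \<omega>)
        \<longlonglongrightarrow> measure \<mu> (cylinder U \<omega>) - perturbed_value F \<epsilon> (measure \<mu>) U \<omega>"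
      by (intro tendsto_diff conv cylinder_clopen[OF U] tendsto_perturbed_value[OF er conv U])
    moreover have "(\<lambda>n. m (r n) (cylinder U \<omega>) - perturbed_value F (e (r n)) (m (r n)) U \<omega>) \<longlonglongrightarrow> 0"
      using LIMSEQ_subseq_LIMSEQ[OF m[OF U] r] by (simp add: o_def)
    ultimately show ?thesis using LIMSEQ_unique by fastforce
  qed
  with \<mu> have "invariant_prob F \<epsilon> \<mu>" by (simp add: invariant_prob_iff[OF \<epsilon>])
  with r conv show ?thesis by blast
qed

text \<open>Krylov--Bogoliubov: the Cesaro averages of an orbit are asymptotically invariant.\<close>

lemma ex_invariant_prob:
  assumes \<epsilon>: "\<epsilon> \<in> {0..1}"
  shows "\<exists>\<mu>. invariant_prob F \<epsilon> \<mu>"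
proof -
  \<comment> \<open>The orbit starts from a point mass; any initial probability measure would
    do.\<close>
  define \<nu> where "\<nu> j = ((\<lambda>M. M \<bind> computer_perturbation F \<epsilon>) ^^ j) (return borel undefined)" for j
  have \<nu>_Suc: "\<nu> (Suc j) = \<nu> j \<bind> computer_perturbation F \<epsilon>" for j by (simp add: \<nu>_def)
  have \<nu>: "prob_space (\<nu> j) \<and> sets (\<nu> j) = sets borel" for j
  proof (induction j)
    case 0
    show ?case by (simp add: \<nu>_def prob_space_return)
  next
    case (Suc j)
    then show ?case by (simp add: \<nu>_Suc bind_computer_perturbation[OF \<epsilon>])
  qed
  define m where "m n A = (\<Sum>j<Suc n. measure (\<nu> j) A) / real (Suc n)" for n A
  have charge: "clopen_charge (measure (\<nu> j))" for j
    using \<nu>[of j] by (simp add: clopen_charge_measure)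
  have "clopen_charge (m n)" for n
    unfolding clopen_charge_def
  proof (intro conjI ballI impI)
    show "0 \<le> m n A" for A unfolding m_def by (intro divide_nonneg_nonneg sum_nonneg) auto
    have "measure (\<nu> j) UNIV = 1" for j using charge[of j] by (simp add: clopen_charge_def)
    then show "m n UNIV = 1" unfolding m_def by (simp del: sum.lessThan_Suc)
    fix A B :: "(nat \<Rightarrow> 'a) set" assume "A \<in> clopens" "B \<in> clopens" "A \<inter> B = {}"
    then have "measure (\<nu> j) (A \<union> B) = measure (\<nu> j) A + measure (\<nu> j) B" for j
      using charge[of j] by (auto simp: clopen_charge_def)
    then show "m n (A \<union> B) = m n A + m n B"
      unfolding m_def by (simp only: sum.distrib add_divide_distrib)
  qed
  moreover have "(\<lambda>n. m n (cylinder U \<omega>) - perturbed_value F \<epsilon> (m n) U \<omega>) \<longlonglongrightarrow> 0"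
    if U: "finite U" for U \<omega>
  proof (rule Lim_null_comparison)
    let ?a = "\<lambda>j. measure (\<nu> j) (cylinder U \<omega>)"
    have bound: "0 \<le> ?a j \<and> ?a j \<le> 1" for j
      using clopen_charge_le_1[OF charge cylinder_clopen[OF U]] by simp
    \<comment> \<open>By linearity the average can be pulled out. The \<open>j\<close>-th term is
      then the mass under \<open>\<nu> (Suc j)\<close>, so the defect telescopes.\<close>
    have "perturbed_value F \<epsilon> (m n) U \<omega>
        = (\<Sum>j<Suc n. perturbed_value F \<epsilon> (measure (\<nu> j)) U \<omega>) / real (Suc n)" for n
      unfolding perturbed_value_def m_def sum_divide_distrib
      by (subst sum.swap) (simp only: sum_distrib_right sum_divide_distrib times_divide_eq_left)
    also have "\<dots> n = (\<Sum>j<Suc n. ?a (Suc j)) / real (Suc n)" for n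
      using \<nu> by (simp add: \<nu>_Suc measure_bind_computer_perturbation[OF \<epsilon> _ _ U] del: sum.lessThan_Suc)
    finally have "m n (cylinder U \<omega>) - perturbed_value F \<epsilon> (m n) U \<omega>
        = (\<Sum>j<Suc n. ?a j - ?a (Suc j)) / real (Suc n)" for n
      unfolding m_def by (simp only: sum_subtractf diff_divide_distrib)
    also have "\<dots> n = (?a 0 - ?a (Suc n)) / real (Suc n)" for n
      using sum_lessThan_telescope'[of ?a "Suc n"] by simp
    finally have diff: "m n (cylinder U \<omega>) - perturbed_value F \<epsilon> (m n) U \<omega>
        = (?a 0 - ?a (Suc n)) / real (Suc n)" for n .
    have "norm (m n (cylinder U \<omega>) - perturbed_value F \<epsilon> (m n) U \<omega>) \<le> 1 / real (Suc n)" for n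
    proof -
      have "\<bar>?a 0 - ?a (Suc n)\<bar> \<le> 1" using bound[of 0] bound[of "Suc n"] by linarith
      then show ?thesis
        unfolding diff real_norm_def abs_divide abs_of_nat by (rule divide_right_mono) simp
    qed
    then show "\<forall>\<^sub>F n in sequentially.
        norm (m n (cylinder U \<omega>) - perturbed_value F \<epsilon> (m n) U \<omega>) \<le> 1 / real (Suc n)" by simp
    show "(\<lambda>n. 1 / real (Suc n)) \<longlonglongrightarrow> 0"
      using LIMSEQ_inverse_real_of_nat by (simp add: inverse_eq_divide)
  qed
  ultimately show ?thesis using invariant_prob_limit[of m "\<lambda>_. \<epsilon>" \<epsilon>] \<epsilon> by auto
qed

section \<open>Uniqueness at full noise\<close>

text \<open>At \<open>\<epsilon> = 1\<close> the next state forgets the current one: every weight is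
  \<open>(1 / real CARD('a)) ^ card U\<close>. So every invariant measure agrees with the uniform
  product measure on cylinders.\<close>

lemma one_mem_Uni: "1 \<in> Uni F"
proof -
  have "\<mu> = \<nu>" if "invariant_prob F 1 \<mu>" "invariant_prob F 1 \<nu>" for \<mu> \<nu>
  proof (rule measure_eqI_cylinders)
    have pv: "perturbed_value F 1 (measure M) U \<omega> = (1 / real CARD('a)) ^ card U"
      if M: "invariant_prob F 1 M" and U: "finite U" for M U \<omega>
    proof -
      have w: "cylinder_weight 1 U \<eta> \<xi> = (1 / real CARD('a)) ^ card U" for \<eta> \<xi> :: "nat \<Rightarrow> 'a"
        by (simp add: cylinder_weight_def)
      have "perturbed_value F 1 (measure M) U \<omega>
          = (\<Sum>\<eta>\<in>U \<rightarrow>\<^sub>E UNIV. measure M (F -` cylinder U \<eta>)) * (1 / real CARD('a)) ^ card U"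
        by (simp only: perturbed_value_def w sum_distrib_right)
      \<comment> \<open>The preimages under \<open>F\<close> of the cylinders over \<open>U\<close>
        partition the space.\<close>
      moreover have "(\<Sum>\<eta>\<in>U \<rightarrow>\<^sub>E UNIV. measure M (F -` cylinder U \<eta>)) = 1"
      proof -
        interpret prob_space M using M by (simp add: invariant_prob_def)
        have sM: "sets M = sets borel" using M by (simp add: invariant_prob_def)
        then have "space M = UNIV" by (metis sets_eq_imp_space_eq space_borel)
        moreover have "(\<Union>\<eta>\<in>U \<rightarrow>\<^sub>E UNIV. F -` cylinder U \<eta>) = UNIV"
        proof -
          have "x \<in> F -` cylinder U (restrict (F x) U)" and "restrict (F x) U \<in> U \<rightarrow>\<^sub>E UNIV" for x
            by (auto simp: cylinder_def)
          then show ?thesis by blast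
        qed
        moreover have "disjoint_family_on (\<lambda>\<eta>. F -` cylinder U \<eta>) (U \<rightarrow>\<^sub>E UNIV)"
          by (auto simp: disjoint_family_on_def mem_cylinder_iff_restrict)
        moreover have "(\<lambda>\<eta>. F -` cylinder U \<eta>) ` (U \<rightarrow>\<^sub>E UNIV) \<subseteq> sets M"
          using clopens_vimage[OF F cylinder_clopen[OF U]] by (auto simp: sM clopens_borel)
        moreover have "finite (U \<rightarrow>\<^sub>E (UNIV :: 'a set))" using U by (intro finite_PiE) auto
        ultimately show ?thesis
          by (metis finite_measure_finite_Union prob_space)
      qed
      ultimately show ?thesis by simp
    qed
    show "measure \<mu> (cylinder U \<omega>) = measure \<nu> (cylinder U \<omega>)" if "finite U" for U \<omega>
    proof -
      have "measure M (cylinder U \<omega>) = (1 / real CARD('a)) ^ card U" if M: "invariant_prob F 1 M" for M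
        using M invariant_prob_iff[of 1 M] pv[OF M \<open>finite U\<close>] \<open>finite U\<close> by simp
      then show ?thesis using \<open>invariant_prob F 1 \<mu>\<close> \<open>invariant_prob F 1 \<nu>\<close> by simp
    qed
  qed (use that in \<open>auto simp: invariant_prob_def\<close>)
  moreover have "\<exists>\<mu>. invariant_prob F 1 \<mu>" by (rule ex_invariant_prob) simp
  ultimately show ?thesis unfolding Uni_def by auto
qed

section \<open>The parameters without uniqueness\<close>

text \<open>A non-strict bound by a fixed \<open>\<delta>\<close> survives limits, whereas mere
  distinctness of two measures need not. Along convergent parameters both measures subconverge to
  invariant ones, with convergence on the clopen set \<open>A\<close>.\<close>

lemma closed_separated_parameters:
  assumes A: "A \<in> clopens"
  shows "closed {\<epsilon> \<in> {0..1}. \<exists>\<mu> \<nu>. invariant_prob F \<epsilon> \<mu> \<and> invariant_prob F \<epsilon> \<nu> \<and>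
    \<delta> \<le> measure \<mu> A - measure \<nu> A}" (is "closed ?S")
  unfolding closed_sequential_limits
proof (intro allI impI, elim conjE)
  fix e \<epsilon> assume e: "\<forall>n. e n \<in> ?S" and lim: "e \<longlonglongrightarrow> \<epsilon>"
  have \<epsilon>: "\<epsilon> \<in> {0..1}"
    using closed_sequentially[of "{0..1::real}" e \<epsilon>] e lim by auto
  obtain \<mu> \<nu> where \<mu>: "\<And>n. invariant_prob F (e n) (\<mu> n)" and \<nu>: "\<And>n. invariant_prob F (e n) (\<nu> n)"
    and \<delta>: "\<And>n. \<delta> \<le> measure (\<mu> n) A - measure (\<nu> n) A"
    using e by simp metis
  have charge: "clopen_charge (measure M)" if "invariant_prob F (e n) M" for n M
    using that by (simp add: clopen_charge_measure invariant_prob_def)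
  have inv: "measure M (cylinder U \<omega>) - perturbed_value F (e n) (measure M) U \<omega> = 0"
    if "invariant_prob F (e n) M" "finite U" for n M U \<omega>
    using that e invariant_prob_iff[of "e n" M] by simp
  obtain r \<mu>' where r: "strict_mono r" and \<mu>': "invariant_prob F \<epsilon> \<mu>'"
    and lim1: "(\<lambda>n. measure (\<mu> (r n)) A) \<longlonglongrightarrow> measure \<mu>' A"
    using invariant_prob_limit[of "\<lambda>n. measure (\<mu> n)" e \<epsilon>] charge[OF \<mu>] inv[OF \<mu>] lim \<epsilon> A by auto
  \<comment> \<open>The second extraction is made along \<open>r\<close>, so that both sequences
    converge along the common subsequence \<open>r (s n)\<close>.\<close>
  have "(\<lambda>n. e (r n)) \<longlonglongrightarrow> \<epsilon>" using LIMSEQ_subseq_LIMSEQ[OF lim r] by (simp add: o_def)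
  then obtain s \<nu>' where s: "strict_mono s" and \<nu>': "invariant_prob F \<epsilon> \<nu>'"
    and lim2: "(\<lambda>n. measure (\<nu> (r (s n))) A) \<longlonglongrightarrow> measure \<nu>' A"
    using invariant_prob_limit[of "\<lambda>n. measure (\<nu> (r n))" "\<lambda>n. e (r n)" \<epsilon>] charge[OF \<nu>] inv[OF \<nu>] \<epsilon> A
    by auto
  have "(\<lambda>n. measure (\<mu> (r (s n))) A) \<longlonglongrightarrow> measure \<mu>' A"
    using LIMSEQ_subseq_LIMSEQ[OF lim1 s] by (simp add: o_def)
  from tendsto_diff[OF this lim2] have "\<delta> \<le> measure \<mu>' A - measure \<nu>' A"
    by (rule LIMSEQ_le_const) (use \<delta> in blast)
  with \<epsilon> \<mu>' \<nu>' show "\<epsilon> \<in> ?S" by blast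
qed

text \<open>Since existence always holds, failure of uniqueness means two invariant measures. These
  differ on some cylinder, by at least \<open>1 / real (Suc n)\<close> for some \<open>n\<close>,
  which writes the complement as a countable union of closed sets.\<close>

lemma gdelta_in_Uni: "gdelta_in (top_of_set {0..1}) (Uni F)"
proof -
  define S where "S A n = {\<epsilon> \<in> {0..1}. \<exists>\<mu> \<nu>. invariant_prob F \<epsilon> \<mu> \<and> invariant_prob F \<epsilon> \<nu> \<and>
    1 / real (Suc n) \<le> measure \<mu> A - measure \<nu> A}" for A n
  have "{0..1} - Uni F = (\<Union>(A, n)\<in>clopens \<times> UNIV. S A n)"
  proof (intro equalityI subsetI)
    fix \<epsilon> assume \<epsilon>: "\<epsilon> \<in> {0..1} - Uni F"
    then obtain \<mu> \<nu> where inv: "invariant_prob F \<epsilon> \<mu>" "invariant_prob F \<epsilon> \<nu>" and "\<mu> \<noteq> \<nu>"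
      using ex_invariant_prob[of \<epsilon>] unfolding Uni_def by blast
    then obtain U \<omega> where U: "finite U" and "measure \<mu> (cylinder U \<omega>) \<noteq> measure \<nu> (cylinder U \<omega>)"
      using measure_eqI_cylinders[of \<mu> \<nu>] by (auto simp: invariant_prob_def)
    \<comment> \<open>\<open>S\<close> uses a signed difference, so the two measures are taken in
      the order that makes it positive.\<close>
    then obtain \<mu>' \<nu>' where inv': "invariant_prob F \<epsilon> \<mu>'" "invariant_prob F \<epsilon> \<nu>'"
      and gt: "0 < measure \<mu>' (cylinder U \<omega>) - measure \<nu>' (cylinder U \<omega>)"
      using inv by (metis diff_gt_0_iff_gt linorder_neqE_linordered_idom)
    obtain n where "1 / real (Suc n) < measure \<mu>' (cylinder U \<omega>) - measure \<nu>' (cylinder U \<omega>)"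
      using nat_approx_posE[OF gt] by blast
    then have "\<epsilon> \<in> S (cylinder U \<omega>) n" using \<epsilon> inv' unfolding S_def by force
    then show "\<epsilon> \<in> (\<Union>(A, n)\<in>clopens \<times> UNIV. S A n)" using cylinder_clopen[OF U] by blast
  next
    fix \<epsilon> assume "\<epsilon> \<in> (\<Union>(A, n)\<in>clopens \<times> UNIV. S A n)"
    then obtain A n \<mu> \<nu> where "\<epsilon> \<in> {0..1}" "invariant_prob F \<epsilon> \<mu>" "invariant_prob F \<epsilon> \<nu>"
      and le: "1 / real (Suc n) \<le> measure \<mu> A - measure \<nu> A"
      unfolding S_def by blast
    moreover have "0 < 1 / real (Suc n)" by simp
    then have "\<mu> \<noteq> \<nu>" using le by auto
    ultimately show "\<epsilon> \<in> {0..1} - Uni F" unfolding Uni_def by blast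
  qed
  moreover have "fsigma_in (top_of_set {0..1}) (\<Union>(A, n)\<in>clopens \<times> UNIV. S A n)"
  proof (rule fsigma_in_Union)
    show "countable ((\<lambda>(A, n). S A n) ` (clopens \<times> UNIV))"
      using countable_clopens_sequences by auto
    show "fsigma_in (top_of_set {0..1}) T" if T: "T \<in> (\<lambda>(A, n). S A n) ` (clopens \<times> UNIV)" for T
    proof (rule closed_imp_fsigma_in)
      from T obtain A n where A: "A \<in> clopens" "T = S A n" by auto
      then have "closed T" using closed_separated_parameters[OF A(1)] by (simp add: S_def)
      moreover have "T \<subseteq> {0..1}" using A by (auto simp: S_def)
      ultimately show "closedin (top_of_set {0..1}) T" by (simp add: closed_subset)
    qed
  qed
  moreover have "Uni F \<subseteq> {0..1}" by (auto simp: Uni_def)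
  ultimately show ?thesis by (simp add: gdelta_in_fsigma_in)
qed

end

theorem proposition2p3:
  fixes F :: "(nat \<Rightarrow> 'a::{finite, discrete_topology}) \<Rightarrow> (nat \<Rightarrow> 'a)"
  assumes "continuous_on UNIV F"
  shows "gdelta_in (top_of_set {0..1::real}) (Uni F) \<and> 1 \<in> Uni F"
  using gdelta_in_Uni[OF assms] one_mem_Uni[OF assms] by blast

end
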